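(* Let $A$ be an algebra over a field $\mathbb{K}$ of characteristic zero, with a (two-sided) unit element $e$, satisfying the identity $(x^p,x^q,x^r)=0$ for all $x\in A$, for some fixed $p,q,r\in\{1,2\}$. Then $A$ is third power-associative, i.e. $(x,x,x)=0$ for all $x\in A$.
   Context: An algebra over a field is a vector space (of arbitrary dimension) with a bilinear product, not assumed associative or commutative. The associator is $(x,y,z)=(xy)z-x(yz)$; $x^1=x$ and $x^2=xx$. *)

theory Defs
  imports Complex_Main
begin

locale nonassoc_algebra = vector_space scale
  for scale :: "'k::field \<Rightarrow> 'a::ab_group_add \<Rightarrow> 'a"  (infixr \<open>*s\<close> 75) +
  fixes prd :: "'a \<Rightarrow> 'a \<Rightarrow> 'a"  (infixl \<open>\<bullet>\<close> 70)
  assumes linear_left: "Vector_Spaces.linear scale scale (\<lambda>x. x \<bullet> y)"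
    and linear_right: "Vector_Spaces.linear scale scale (\<lambda>y. x \<bullet> y)"
begin

definition associator :: "'a \<Rightarrow> 'a \<Rightarrow> 'a \<Rightarrow> 'a"
  where "associator x y z = (x \<bullet> y) \<bullet> z - x \<bullet> (y \<bullet> z)"

(* The bracketing is a convention that plays no role for exponents 1 and 2;
   the value at exponent 0 is left unspecified. *)
fun pow :: "'a \<Rightarrow> nat \<Rightarrow> 'a"
  where
    "pow x (Suc 0) = x"
  | "pow x (Suc (Suc n)) = pow x (Suc n) \<bullet> x"

definition is_unit_element :: "'a \<Rightarrow> bool"
  where "is_unit_element e \<longleftrightarrow> (\<forall>x. e \<bullet> x = x \<and> x \<bullet> e = x)"

definition third_power_associative :: bool
  where "third_power_associative \<longleftrightarrow> (\<forall>x. associator x x x = 0)"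

end

end

theory Submission
  imports Defs
begin

text \<open>Substitute \<open>e + t x\<close> for \<open>x\<close>. Associators with an entry \<open>e\<close> vanish and
  \<open>(e + t x)\<^sup>p = e + t (p x + t (p - 1) x\<^sup>2)\<close> for \<open>p \<in> {1, 2}\<close>, so after division by
  \<open>t\<^sup>3\<close> the identity is a cubic polynomial in \<open>t\<close> with constant term \<open>p q r (x, x, x)\<close>,
  vanishing at all nonzero \<open>t\<close>.\<close>

text \<open>Write \<open>f t\<close> for the cubic. In \<open>f t + f (-t)\<close> the odd
  coefficients cancel, and \<open>4 (f 1 + f (-1)) - (f 2 + f (-2))\<close> also removes
  \<open>c2\<close>, leaving \<open>6 c0\<close>.\<close>

lemma (in vector_space) cubic_constant_coeff_eq_0:
  assumes six: "(6::'a) \<noteq> 0"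
    and zero: "\<And>t. t \<noteq> 0 \<Longrightarrow> c0 + t *s c1 + t^2 *s c2 + t^3 *s c3 = 0"
  shows "c0 = 0"
proof -
  \<comment> \<open>This makes 2 and -2 admissible values of \<open>t\<close>.\<close>
  have "(2::'a) * 3 \<noteq> 0"
    using six by simp
  then have "(2::'a) \<noteq> 0"
    by (metis mult_zero_left)
  then have z: "c0 + 1 *s c1 + 1^2 *s c2 + 1^3 *s c3 = 0"
    "c0 + (-1) *s c1 + (-1)^2 *s c2 + (-1)^3 *s c3 = 0"
    "c0 + 2 *s c1 + 2^2 *s c2 + 2^3 *s c3 = 0"
    "c0 + (-2) *s c1 + (-2)^2 *s c2 + (-2)^3 *s c3 = 0"
    by (intro zero; simp)+
  \<comment> \<open>With numeral multiples written as repeated sums, the identity below is mere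
    cancellation in an abelian group.\<close>
  have numeral_scale: "2 *s u = u + u" "4 *s u = u + u + u + u" "6 *s u = u + u + u + u + u + u"
    "8 *s u = u + u + u + u + u + u + u + u" for u
    by (simp_all only: numeral_Bit0 numeral_Bit1 numeral_One scale_left_distrib scale_one add.assoc)
  have "6 *s c0 =
      4 *s (c0 + 1 *s c1 + 1^2 *s c2 + 1^3 *s c3)
    + 4 *s (c0 + (-1) *s c1 + (-1)^2 *s c2 + (-1)^3 *s c3)
    - (c0 + 2 *s c1 + 2^2 *s c2 + 2^3 *s c3)
    - (c0 + (-2) *s c1 + (-2)^2 *s c2 + (-2)^3 *s c3)"
    by (simp add: numeral_scale)
  also have "\<dots> = 0"
    unfolding z by simp
  finally show ?thesis
    using six by simp
qed

context nonassoc_algebra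
begin

lemma prd_bilinear:
  "(x + y) \<bullet> z = x \<bullet> z + y \<bullet> z" "x \<bullet> (y + z) = x \<bullet> y + x \<bullet> z"
  "(c *s x) \<bullet> y = c *s (x \<bullet> y)" "x \<bullet> (c *s y) = c *s (x \<bullet> y)"
  using linear_left linear_right unfolding Vector_Spaces.linear_iff by auto

lemma associator_trilinear:
  "associator (x + x') y z = associator x y z + associator x' y z"
  "associator x (y + y') z = associator x y z + associator x y' z"
  "associator x y (z + z') = associator x y z + associator x y z'"
  "associator (c *s x) y z = c *s associator x y z"
  "associator x (c *s y) z = c *s associator x y z"
  "associator x y (c *s z) = c *s associator x y z"
  by (simp_all add: associator_def prd_bilinear scale_right_diff_distrib)

lemma associator_unit_eq_0:
  assumes "is_unit_element e"
  shows "associator e y z = 0" "associator x e z = 0" "associator x y e = 0"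
  using assms by (simp_all add: associator_def is_unit_element_def)

text \<open>One formula covers both exponents: the factor \<open>p - 1\<close> switches the square
  off for \<open>p = 1\<close> and on for \<open>p = 2\<close>.\<close>

lemma pow_unit_add:
  assumes "is_unit_element e" and "p \<in> {1, 2}"
  shows "pow (e + t *s x) p = e + t *s (of_nat p *s x + t *s (of_nat (p - 1) *s (x \<bullet> x)))"
proof -
  \<comment> \<open>For \<open>p = 2\<close> the two cross terms with \<open>e\<close> each
    contribute \<open>t *s x\<close>.\<close>
  have "(t * 2) *s x = t *s x + t *s x"
    by (simp only: mult_2_right scale_left_distrib)
  moreover have "pow y 2 = y \<bullet> y" for y
    by (simp add: numeral_2_eq_2)
  ultimately show ?thesis
    using assms by (auto simp: is_unit_element_def prd_bilinear scale_right_distrib add.assoc)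
qed

end

theorem proposition2:
  fixes scale :: "'k::field_char_0 \<Rightarrow> 'a::ab_group_add \<Rightarrow> 'a"
    and prd :: "'a \<Rightarrow> 'a \<Rightarrow> 'a"
    and e :: 'a
    and p q r :: nat
  assumes "nonassoc_algebra scale prd"
    and "nonassoc_algebra.is_unit_element prd e"
    and "p \<in> {1, 2}" and "q \<in> {1, 2}" and "r \<in> {1, 2}"
    and "\<forall>x. nonassoc_algebra.associator prd
               (nonassoc_algebra.pow prd x p)
               (nonassoc_algebra.pow prd x q)
               (nonassoc_algebra.pow prd x r) = 0"
  shows "nonassoc_algebra.third_power_associative prd"
proof -
  interpret nonassoc_algebra scale prd by fact
  have "associator x x x = 0" for x
  proof -
    define v where "v = prd x x"
    \<comment> \<open>Chosen so that \<open>pow (e + scale t x) n = e + scale t (y n t)\<close> for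
      \<open>n\<close> in \<open>{1, 2}\<close>.\<close>
    define y where "y n t = scale (of_nat n) x + scale t (scale (of_nat (n - 1)) v)" for n t
    define a where "a n = (of_nat n :: 'k)" for n
    have y0: "associator (y p t) (y q t) (y r t) = 0" if "t \<noteq> 0" for t
    proof -
      have "0 = associator (pow (e + scale t x) p) (pow (e + scale t x) q) (pow (e + scale t x) r)"
        using assms(6) by simp
      also have "\<dots> = associator (e + scale t (y p t)) (e + scale t (y q t)) (e + scale t (y r t))"
        using assms(2-5) by (simp only: pow_unit_add y_def v_def)
      \<comment> \<open>The other seven terms of the trilinear expansion have an entry
        \<open>e\<close>.\<close>
      also have "\<dots> = scale (t^3) (associator (y p t) (y q t) (y r t))"
        using assms(2) by (simp add: associator_trilinear associator_unit_eq_0 power3_eq_cube mult.assoc)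
      finally show ?thesis
        using that by simp
    qed
    \<comment> \<open>The coefficient of \<open>t^k\<close> collects the terms with \<open>v\<close>
      in exactly \<open>k\<close> of the three entries.\<close>
    have "scale (a p * a q * a r) (associator x x x)
      + scale t (scale (a (p - 1) * a q * a r) (associator v x x)
               + scale (a p * a (q - 1) * a r) (associator x v x)
               + scale (a p * a q * a (r - 1)) (associator x x v))
      + scale (t^2) (scale (a (p - 1) * a (q - 1) * a r) (associator v v x)
               + scale (a (p - 1) * a q * a (r - 1)) (associator v x v)
               + scale (a p * a (q - 1) * a (r - 1)) (associator x v v))
      + scale (t^3) (scale (a (p - 1) * a (q - 1) * a (r - 1)) (associator v v v)) = 0" if "t \<noteq> 0" for t
      using y0[OF that] unfolding y_def a_def[symmetric]
      by (simp only: associator_trilinear scale_right_distrib scale_scale power2_eq_square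
          power3_eq_cube ac_simps)
    \<comment> \<open>Characteristic zero gives \<open>6 \<noteq> 0\<close> here, and the
      nonvanishing of \<open>p q r\<close> in the next step.\<close>
    then have "scale (a p * a q * a r) (associator x x x) = 0"
      by (rule cubic_constant_coeff_eq_0[rotated]) simp_all
    then show ?thesis
      using assms(3-5) by (auto simp: a_def)
  qed
  then show ?thesis
    by (simp add: third_power_associative_def)
qed

end
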